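(* Let $f:\mathbb{R}^n\to\mathbb{R}$, $g:\mathbb{R}^n\to\mathbb{R}^m$, $h:\mathbb{R}^n\to\mathbb{R}^p$ be continuously differentiable, let $\varphi:\mathbb{R}^n\to\mathbb{R}$ be locally Lipschitz continuous (in particular, in a neighborhood of the point $x^*$ below), and consider the problem $$\min_{x\in\mathbb{R}^n} f(x)+\varphi(x)\quad\text{s.t.}\quad g(x)\le 0,\ h(x)=0 .$$ Let $x^*$ be feasible, i.e. $g(x^* )\le0$ and $h(x^* )=0$. Suppose that the Polyak-Łojasiewicz constraint qualification (PŁCQ) holds at $x^*$, and that there is an infinite subset $K\subseteq\mathbb{N}$ such that the sequence $\{x^k\}$ generated by the Safeguarded Augmented Lagrangian Method (SALM, described in the context) converges to $x^*$ along $K$. Then the associated multiplier subsequences $\{\lambda^k\}_{k\in K}$ and $\{\mu^k\}_{k\in K}$ are bounded.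
   Context: Notation: $\|\cdot\|$ is the Euclidean norm; $B_\delta(x)$ is the open Euclidean ball; $v_+$ is the componentwise maximum of $v$ and $0$; $\min\{\cdot,\cdot\}$ of vectors is componentwise; vector inequalities are componentwise. PŁCQ: let $\Phi(x)=\frac12(\|g(x)_+\|^2+\|h(x)\|^2)$. PŁCQ holds at a feasible point $x^*$ if there are constants $\nu>0$, $\delta>0$ with $\sqrt{\Phi(x)}\le\nu\|\nabla\Phi(x)\|$ for all $x\in B_\delta(x^* )$. Subdifferentials: for a proper lsc $\theta:\mathbb{R}^n\to\mathbb{R}\cup\{\pm\infty\}$ and $\bar x\in\operatorname{dom}\theta$, the Fréchet subdifferential is $\hat\partial\theta(\bar x)=\{v:\liminf_{x\to\bar x,\,x\ne\bar x}\frac{\theta(x)-\theta(\bar x)-v^T(x-\bar x)}{\|x-\bar x\|}\ge 0\}$, and the limiting (Mordukhovich) subdifferential $\partial\theta(\bar x)$ is the set of all $v$ for which there exist $x^k\to\bar x$ with $\theta(x^k)\to\theta(\bar x)$ and $v^k\to v$ with $v^k\in\hat\partial\theta(x^k)$ for all $k$. A point $\bar x\in\operatorname{dom}\theta$ is $\varepsilon$-stationary for $\min\theta$ if there is $\eta\in\partial\theta(\bar x)$ with $\|\eta\|\le\varepsilon$. Augmented Lagrangian ($\rho>0$): $\mathcal{L}_\rho(x,\lambda,\mu)=f(x)+\varphi(x)+\frac{\rho}{2}\left(\left\|\left(g(x)+\frac{\lambda}{\rho}\right)_+\right\|^2+\left\|h(x)+\frac{\mu}{\rho}\right\|^2\right)$.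 SALM: Data: $u_{\max}>0$, $v_{\min}<v_{\max}$, sequences $\{u^k\}_{k\ge0}\subseteq[0,u_{\max}]^m$ and $\{v^k\}_{k\ge0}\subseteq[v_{\min},v_{\max}]^p$, a sequence $\varepsilon_k>0$ with $\varepsilon_k\to0$, a starting point $(x^0,\lambda^0,\mu^0)\in\mathbb{R}^n\times\mathbb{R}^m_+\times\mathbb{R}^p$, $\rho_0>0$, $\tau\in(0,1)$, $\gamma>1$. For $k=0,1,2,\dots$ (the method is assumed not to terminate): (1) choose $x^{k+1}$ as an $\varepsilon_k$-stationary point of $\min_x\mathcal{L}_{\rho_k}(x,u^k,v^k)$; (2) set $\lambda_i^{k+1}=(u_i^k+\rho_kg_i(x^{k+1}))_+$ for $i=1,\dots,m$ and $\mu_j^{k+1}=v_j^k+\rho_kh_j(x^{k+1})$ for $j=1,\dots,p$; (3) if $k=0$, or if both $\|h(x^{k+1})\|\le\tau\|h(x^k)\|$ and $\left\|\min\{-g(x^{k+1}),u^k/\rho_k\}\right\|\le\tau\left\|\min\{-g(x^k),u^{k-1}/\rho_{k-1}\}\right\|$, set $\rho_{k+1}=\rho_k$; otherwise set $\rho_{k+1}=\gamma\rho_k$. *)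

theory Defs
  imports "HOL-Analysis.Analysis"
begin

definition C1 :: "('a::real_normed_vector \<Rightarrow> 'b::real_normed_vector) \<Rightarrow> bool" where
  "C1 F \<longleftrightarrow> (\<exists>F' :: 'a \<Rightarrow> 'a \<Rightarrow>\<^sub>L 'b.
     (\<forall>x. (F has_derivative blinfun_apply (F' x)) (at x)) \<and> continuous_on UNIV F')"

definition locally_lipschitz :: "('a::metric_space \<Rightarrow> 'b::metric_space) \<Rightarrow> bool" where
  "locally_lipschitz F \<longleftrightarrow> (\<forall>x. \<exists>d>0. \<exists>L. L-lipschitz_on (ball x d) F)"

definition gradient :: "('a::real_inner \<Rightarrow> real) \<Rightarrow> 'a \<Rightarrow> 'a" where
  "gradient F x = (THE D. GDERIV F x :> D)"

text \<open>On \<open>real ^ 'm\<close> the operations \<^const>\<open>sup\<close>, \<^const>\<open>inf\<close> and the order \<open>\<le>\<close> are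
  componentwise.\<close>

abbreviation pos_part :: "real ^ 'm \<Rightarrow> real ^ 'm" where
  "pos_part v \<equiv> sup v 0"

definition infeasibility ::
  "('a \<Rightarrow> real ^ 'm) \<Rightarrow> ('a \<Rightarrow> real ^ 'p) \<Rightarrow> 'a \<Rightarrow> real" where
  "infeasibility g h x = 1/2 * ((norm (pos_part (g x)))\<^sup>2 + (norm (h x))\<^sup>2)"

definition PLCQ ::
  "(real ^ 'n \<Rightarrow> real ^ 'm) \<Rightarrow> (real ^ 'n \<Rightarrow> real ^ 'p) \<Rightarrow> real ^ 'n \<Rightarrow> bool" where
  "PLCQ g h xs \<longleftrightarrow> (\<exists>\<nu>>0. \<exists>\<delta>>0. \<forall>x\<in>ball xs \<delta>.
     sqrt (infeasibility g h x) \<le> \<nu> * norm (gradient (infeasibility g h) x))"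

definition finite_dom :: "('a \<Rightarrow> ereal) \<Rightarrow> 'a set" where
  "finite_dom \<theta> = {x. \<bar>\<theta> x\<bar> \<noteq> \<infinity>}"

text \<open>Both subdifferentials are meant for proper lower semicontinuous functions; the Frechet
  subdifferential is taken to be empty outside the domain.\<close>

definition frechet_subdifferential :: "('a::real_inner \<Rightarrow> ereal) \<Rightarrow> 'a \<Rightarrow> 'a set" where
  "frechet_subdifferential \<theta> xb = {v. xb \<in> finite_dom \<theta> \<and>
     0 \<le> Liminf (at xb) (\<lambda>x. (\<theta> x - \<theta> xb - ereal (v \<bullet> (x - xb))) / ereal (norm (x - xb)))}"

definition limiting_subdifferential :: "('a::real_inner \<Rightarrow> ereal) \<Rightarrow> 'a \<Rightarrow> 'a set" where
  "limiting_subdifferential \<theta> xb = {v. \<exists>X V.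
     X \<longlonglongrightarrow> xb \<and> (\<lambda>k. \<theta> (X k)) \<longlonglongrightarrow> \<theta> xb \<and> V \<longlonglongrightarrow> v \<and>
     (\<forall>k::nat. V k \<in> frechet_subdifferential \<theta> (X k))}"

definition eps_stationary :: "real \<Rightarrow> ('a::real_inner \<Rightarrow> ereal) \<Rightarrow> 'a \<Rightarrow> bool" where
  "eps_stationary \<epsilon> \<theta> xb \<longleftrightarrow>
     xb \<in> finite_dom \<theta> \<and> (\<exists>\<eta>\<in>limiting_subdifferential \<theta> xb. norm \<eta> \<le> \<epsilon>)"

definition aug_lagrangian ::
  "('a \<Rightarrow> real) \<Rightarrow> ('a \<Rightarrow> real) \<Rightarrow> ('a \<Rightarrow> real ^ 'm) \<Rightarrow> ('a \<Rightarrow> real ^ 'p) \<Rightarrow>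
   real \<Rightarrow> 'a \<Rightarrow> real ^ 'm \<Rightarrow> real ^ 'p \<Rightarrow> real" where
  "aug_lagrangian f \<phi> g h \<rho> x l m = f x + \<phi> x +
     \<rho> / 2 * ((norm (pos_part (g x + (1 / \<rho>) *\<^sub>R l)))\<^sup>2 + (norm (h x + (1 / \<rho>) *\<^sub>R m))\<^sup>2)"

text \<open>A run of the safeguarded augmented Lagrangian method: the point \<open>x (Suc k)\<close> may be any
  \<open>\<epsilon> k\<close>-stationary point, so the iterates are constrained by the method, not computed from the
  data. The index \<open>k - 1\<close> is used for \<open>k \<ge> 1\<close> only.\<close>

locale SALM =
  fixes f \<phi> :: "real ^ 'n \<Rightarrow> real"
    and g :: "real ^ 'n \<Rightarrow> real ^ 'm"
    and h :: "real ^ 'n \<Rightarrow> real ^ 'p"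
    and u_max v_min v_max \<tau> \<gamma> :: real
    and u :: "nat \<Rightarrow> real ^ 'm"
    and v :: "nat \<Rightarrow> real ^ 'p"
    and \<epsilon> \<rho> :: "nat \<Rightarrow> real"
    and x :: "nat \<Rightarrow> real ^ 'n"
    and lam :: "nat \<Rightarrow> real ^ 'm"
    and mu :: "nat \<Rightarrow> real ^ 'p"
  assumes u_max_pos: "u_max > 0"
    and v_min_less_v_max: "v_min < v_max"
    and u_bounds: "\<And>k i. u k $ i \<in> {0..u_max}"
    and v_bounds: "\<And>k j. v k $ j \<in> {v_min..v_max}"
    and eps_pos: "\<And>k. \<epsilon> k > 0"
    and eps_tendsto: "\<epsilon> \<longlonglongrightarrow> 0"
    and lam_0_nonneg: "0 \<le> lam 0"
    and rho_0_pos: "\<rho> 0 > 0"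
    and tau_bounds: "0 < \<tau>" "\<tau> < 1"
    and gamma_gt_1: "\<gamma> > 1"
    and x_step: "\<And>k. eps_stationary (\<epsilon> k)
          (\<lambda>y. ereal (aug_lagrangian f \<phi> g h (\<rho> k) y (u k) (v k))) (x (Suc k))"
    and lam_step: "\<And>k. lam (Suc k) = pos_part (u k + \<rho> k *\<^sub>R g (x (Suc k)))"
    and mu_step: "\<And>k. mu (Suc k) = v k + \<rho> k *\<^sub>R h (x (Suc k))"
    and rho_step: "\<And>k. \<rho> (Suc k) =
          (if k = 0 \<or>
              norm (h (x (Suc k))) \<le> \<tau> * norm (h (x k)) \<and>
              norm (inf (- g (x (Suc k))) ((1 / \<rho> k) *\<^sub>R u k))
                \<le> \<tau> * norm (inf (- g (x k)) ((1 / \<rho> (k - 1)) *\<^sub>R u (k - 1)))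
           then \<rho> k else \<gamma> * \<rho> k)"

end

theory Submission
  imports Defs
begin

text \<open>Since \<open>\<phi>\<close> is Lipschitz near the limit point, approximate stationarity bounds
  \<open>\<nabla>f + \<nabla>g\<^sup>T \<lambda>\<^sup>k\<^sup>+\<^sup>1 + \<nabla>h\<^sup>T \<mu>\<^sup>k\<^sup>+\<^sup>1\<close> along the subsequence. As the safeguarded
  multipliers are bounded, \<open>\<lambda>\<^sup>k\<^sup>+\<^sup>1\<close> and \<open>\<mu>\<^sup>k\<^sup>+\<^sup>1\<close> stay within bounded distance of \<open>\<rho>\<^sub>k g\<^sub>+\<close> and
  \<open>\<rho>\<^sub>k h\<close>, so \<open>\<rho>\<^sub>k \<nabla>\<Phi>\<close> is bounded too. The constraint qualification turns this into a bound on
  \<open>\<rho>\<^sub>k \<surd>\<Phi>\<close>, that is, on \<open>\<rho>\<^sub>k g\<^sub>+\<close> and \<open>\<rho>\<^sub>k h\<close>.\<close>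

section \<open>The squared positive part and the gradient of the penalty\<close>

text \<open>The derivative \<open>2 * max t 0\<close> of \<open>(max t 0)\<^sup>2\<close> is
  Lipschitz with constant 2, so the first-order Taylor remainder is at most
  \<open>d\<^sup>2\<close>. The proof checks this by the signs of \<open>a\<close> and
  \<open>a + d\<close>.\<close>

lemma max_zero_square_remainder:
  "\<bar>(max (a + d) 0)\<^sup>2 - (max a 0)\<^sup>2 - 2 * max a 0 * d\<bar> \<le> d\<^sup>2" for a d :: real
proof (cases "a \<ge> 0"; cases "a + d \<ge> 0")
  assume "a \<ge> 0" "\<not> a + d \<ge> 0"
  \<comment> \<open>Here the remainder is \<open>- a\<^sup>2 - 2 * a * d\<close>. It is at most
    \<open>d\<^sup>2\<close> since \<open>(a + d)\<^sup>2\<close> is nonnegative, and at least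
    \<open>- d\<^sup>2\<close> since \<open>a\<^sup>2 \<le> d\<^sup>2\<close> and
    \<open>a * d \<le> 0\<close>.\<close>
  then have "0 \<le> (- d - a) * (a - d)" and "a * d \<le> 0" "0 \<le> (- d - a) * (- d - a)"
    by (auto intro!: mult_nonneg_nonneg mult_nonneg_nonpos)
  with \<open>a \<ge> 0\<close> \<open>\<not> a + d \<ge> 0\<close> show ?thesis
    by (simp add: max_def abs_le_iff power2_eq_square algebra_simps)
next
  assume "\<not> a \<ge> 0" "a + d \<ge> 0"
  then show ?thesis
    by (auto simp: max_def abs_le_iff intro!: power_mono)
qed (auto simp: max_def abs_le_iff power2_eq_square algebra_simps)

lemma pos_part_nth: "pos_part w $ i = max (w $ i) 0"
  by (simp add: sup_vec_def sup_max)

lemma norm_pos_part_square_remainder: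
  fixes w d :: "real ^ 'm"
  shows "\<bar>(norm (pos_part (w + d)))\<^sup>2 - (norm (pos_part w))\<^sup>2 - 2 * (pos_part w \<bullet> d)\<bar> \<le> (norm d)\<^sup>2"
proof -
  have "(norm (pos_part (w + d)))\<^sup>2 - (norm (pos_part w))\<^sup>2 - 2 * (pos_part w \<bullet> d) =
      (\<Sum>i\<in>UNIV. (max (w $ i + d $ i) 0)\<^sup>2 - (max (w $ i) 0)\<^sup>2 - 2 * max (w $ i) 0 * d $ i)"
    unfolding power2_norm_eq_inner
    by (simp add: inner_vec_def pos_part_nth sum_subtractf sum_distrib_left power2_eq_square mult.assoc)
  also have "\<bar>\<dots>\<bar> \<le> (\<Sum>i\<in>UNIV. (d $ i)\<^sup>2)"
    by (rule order_trans[OF sum_abs]) (intro sum_mono max_zero_square_remainder)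
  also have "\<dots> = (norm d)\<^sup>2"
    unfolding power2_norm_eq_inner by (simp add: inner_vec_def power2_eq_square)
  finally show ?thesis .
qed

lemma has_derivative_norm_pos_part_square:
  fixes w :: "real ^ 'm"
  shows "((\<lambda>w. (norm (pos_part w))\<^sup>2) has_derivative (\<lambda>d. 2 * (pos_part w \<bullet> d))) (at w)"
  unfolding has_derivative_at
proof
  show "bounded_linear (\<lambda>d. 2 * (pos_part w \<bullet> d))"
    by (intro bounded_linear_intros)
  have "\<forall>\<^sub>F d in at 0. norm (norm ((norm (pos_part (w + d)))\<^sup>2 - (norm (pos_part w))\<^sup>2
      - 2 * (pos_part w \<bullet> d)) / norm d) \<le> norm d"
    using norm_pos_part_square_remainder[of w]
    by (auto simp: eventually_at_filter divide_le_eq power2_eq_square)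
  moreover have "((\<lambda>d :: real ^ 'm. norm d) \<longlongrightarrow> 0) (at 0)"
    by (intro tendsto_norm_zero tendsto_ident_at)
  ultimately show "(\<lambda>d. norm ((norm (pos_part (w + d)))\<^sup>2 - (norm (pos_part w))\<^sup>2
      - 2 * (pos_part w \<bullet> d)) / norm d) \<midarrow>0\<rightarrow> 0"
    by (rule Lim_null_comparison)
qed

text \<open>The shifts \<open>a\<close> and \<open>b\<close> let one formula serve twice: zero
  shifts give twice the infeasibility, and scaled multipliers give the quadratic term of the
  augmented Lagrangian.\<close>

lemma shifted_penalty_has_derivative:
  fixes g :: "'a::real_normed_vector \<Rightarrow> real ^ 'm" and h :: "'a \<Rightarrow> real ^ 'p"
  assumes g: "(g has_derivative g') (at y)" and h: "(h has_derivative h') (at y)"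
  shows "((\<lambda>y. (norm (pos_part (g y + a)))\<^sup>2 + (norm (h y + b))\<^sup>2) has_derivative
    (\<lambda>d. 2 * (pos_part (g y + a) \<bullet> g' d + (h y + b) \<bullet> h' d))) (at y)"
proof -
  have "((\<lambda>y. (norm (pos_part (g y + a)))\<^sup>2) has_derivative
      (\<lambda>d. 2 * (pos_part (g y + a) \<bullet> g' d))) (at y)"
    by (rule has_derivative_compose[OF _ has_derivative_norm_pos_part_square])
      (auto intro!: derivative_eq_intros g)
  moreover have "((\<lambda>y. (norm (h y + b))\<^sup>2) has_derivative (\<lambda>d. 2 * ((h y + b) \<bullet> h' d))) (at y)"
    unfolding power2_norm_eq_inner
    by (auto intro!: derivative_eq_intros h simp: inner_commute)
  ultimately show ?thesis
    by (rule has_derivative_eq_rhs[OF has_derivative_add]) (simp add: algebra_simps)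
qed

text \<open>The chain rule gives the gradient through the adjoints of \<open>g'\<close> and
  \<open>h'\<close>. Pairing it with \<open>d\<close> keeps the adjoints out of all later
  estimates.\<close>

lemma inner_gradient_infeasibility:
  fixes g :: "real ^ 'n \<Rightarrow> real ^ 'm" and h :: "real ^ 'n \<Rightarrow> real ^ 'p"
  assumes g: "(g has_derivative g') (at y)" and h: "(h has_derivative h') (at y)"
  shows "d \<bullet> gradient (infeasibility g h) y = pos_part (g y) \<bullet> g' d + h y \<bullet> h' d"
proof -
  let ?D = "adjoint g' (pos_part (g y)) + adjoint h' (h y)"
  have "linear g'" "linear h'"
    using g h by (auto intro: has_derivative_linear)
  then have D: "d \<bullet> ?D = pos_part (g y) \<bullet> g' d + h y \<bullet> h' d" for d
    by (simp add: inner_add_right adjoint_works inner_commute)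
  have "(infeasibility g h has_derivative (\<lambda>d. d \<bullet> ?D)) (at y)"
    using has_derivative_mult_right[OF shifted_penalty_has_derivative[OF g h, of 0 0], of "1/2"]
    unfolding infeasibility_def[abs_def] D by (simp add: add_divide_distrib)
  then have "GDERIV (infeasibility g h) y :> ?D"
    by (simp add: gderiv_def)
  \<comment> \<open>\<open>gradient\<close> is a definite description, so uniqueness of the
    derivative is needed as well.\<close>
  then have "gradient (infeasibility g h) y = ?D"
    unfolding gradient_def
  proof (rule the_equality)
    fix D' assume "GDERIV (infeasibility g h) y :> D'"
    with \<open>GDERIV (infeasibility g h) y :> ?D\<close> have "(\<lambda>d. d \<bullet> D') = (\<lambda>d. d \<bullet> ?D)"
      unfolding gderiv_def by (intro has_derivative_unique)
    then show "D' = ?D"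
      by (metis vector_eq_ldot)
  qed
  with D show ?thesis by simp
qed

section \<open>Subgradients of a Lipschitz plus a smooth function\<close>

text \<open>Along \<open>z + t *\<^sub>R d\<close> the subgradient inequality bounds
  \<open>v \<bullet> d\<close> by the difference quotient of \<open>\<phi> + S\<close>, up to a
  vanishing error. The part from \<open>S\<close> tends to \<open>S' d\<close>, and the part from
  \<open>\<phi>\<close> is at most \<open>L * norm d\<close>. This replaces a sum rule for
  subdifferentials.\<close>

lemma frechet_subdifferential_lipschitz_plus_smooth:
  fixes \<phi> S :: "'a::real_inner \<Rightarrow> real"
  assumes v: "v \<in> frechet_subdifferential (\<lambda>y. ereal (\<phi> y + S y)) z"
    and S: "(S has_derivative S') (at z)"
    and U: "open U" "z \<in> U" and lip: "L-lipschitz_on U \<phi>"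
  shows "v \<bullet> d - S' d \<le> L * norm d"
proof (cases "d = 0")
  case True
  then show ?thesis
    using has_derivative_linear[OF S] by (simp add: linear_0)
next
  case False
  have "v \<bullet> d - S' d \<le> L * norm d + e" if "e > 0" for e
  proof -
    \<comment> \<open>The subgradient inequality and the expansion of \<open>S\<close> each cost
      \<open>c * norm (y - z)\<close>; in direction \<open>d\<close> the two add up to
      \<open>e\<close>.\<close>
    define c where "c = e / (2 * norm d)"
    have c: "c > 0" using \<open>e > 0\<close> False by (simp add: c_def)
    have "ereal (- c) < Liminf (at z)
        (\<lambda>y. (ereal (\<phi> y + S y) - ereal (\<phi> z + S z) - ereal (v \<bullet> (y - z))) / ereal (norm (y - z)))"
      using v c unfolding frechet_subdifferential_def
      by (auto intro: less_le_trans[of _ 0])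
    then have "\<forall>\<^sub>F y in at z. ereal (- c) <
        (ereal (\<phi> y + S y) - ereal (\<phi> z + S z) - ereal (v \<bullet> (y - z))) / ereal (norm (y - z))"
      by (rule less_LiminfD)
    then have 1: "\<forall>\<^sub>F y in at z. - c * norm (y - z) \<le> \<phi> y + S y - (\<phi> z + S z) - v \<bullet> (y - z)"
      unfolding eventually_at_filter
      by eventually_elim (auto simp: ereal_divide field_simps)
    have 2: "\<forall>\<^sub>F y in at z. S y - S z - S' (y - z) \<le> c * norm (y - z)"
    proof -
      obtain r where "r > 0"
        "\<And>y. norm (y - z) < r \<Longrightarrow> norm (S y - S z - S' (y - z)) \<le> c * norm (y - z)"
        using S c unfolding has_derivative_at_alt by blast
      then show ?thesis
        by (force simp: eventually_at dist_norm)
    qed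
    have "\<forall>\<^sub>F y in at z. y \<in> U"
      using U by (rule eventually_at_topological[THEN iffD2, OF exI, OF conjI, OF _ conjI]) auto
    with 1 2 have "\<forall>\<^sub>F y in at z. v \<bullet> (y - z) - S' (y - z) \<le> (L + 2 * c) * norm (y - z)"
    proof eventually_elim
      case (elim y)
      have "\<bar>\<phi> y - \<phi> z\<bar> \<le> L * norm (y - z)"
        using lipschitz_onD[OF lip elim(3) U(2)] by (simp add: dist_norm)
      with elim show ?case by (auto simp: algebra_simps)
    qed
    then obtain r where r: "r > 0" "\<And>y. y \<noteq> z \<Longrightarrow> dist y z < r \<Longrightarrow>
        v \<bullet> (y - z) - S' (y - z) \<le> (L + 2 * c) * norm (y - z)"
      unfolding eventually_at by auto
    define t where "t = r / (2 * norm d)"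
    have t: "t > 0" "t * norm d < r" using r False by (auto simp: t_def)
    have "v \<bullet> (t *\<^sub>R d) - S' (t *\<^sub>R d) \<le> (L + 2 * c) * norm (t *\<^sub>R d)"
      using r(2)[of "z + t *\<^sub>R d"] t False by (simp add: dist_norm)
    then have "t * (v \<bullet> d - S' d) \<le> t * ((L + 2 * c) * norm d)"
      using t has_derivative_linear[OF S] by (simp add: linear_scale algebra_simps)
    then have "v \<bullet> d - S' d \<le> (L + 2 * c) * norm d"
      using t(1) by (simp only: mult_le_cancel_left_pos)
    also have "\<dots> = L * norm d + e"
      using False by (simp add: c_def field_simps)
    finally show ?thesis .
  qed
  then show ?thesis by (rule field_le_epsilon)
qed

text \<open>The bound for Frechet subgradients is a non-strict inequality between continuous
  quantities, and the approximating points eventually lie in \<open>U\<close>, so it passes to the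
  limit.\<close>

lemma limiting_subdifferential_lipschitz_plus_smooth:
  fixes \<phi> S :: "'a::real_inner \<Rightarrow> real"
  assumes v: "v \<in> limiting_subdifferential (\<lambda>y. ereal (\<phi> y + S y)) z"
    and S: "\<And>y. (S has_derivative S' y) (at y)" and cont: "isCont (\<lambda>y. S' y d) z"
    and U: "open U" "z \<in> U" and lip: "L-lipschitz_on U \<phi>"
  shows "v \<bullet> d - S' z d \<le> L * norm d"
proof -
  obtain X V where X: "X \<longlonglongrightarrow> z" and V: "V \<longlonglongrightarrow> v"
    and XV: "\<And>k::nat. V k \<in> frechet_subdifferential (\<lambda>y. ereal (\<phi> y + S y)) (X k)"
    using v unfolding limiting_subdifferential_def by blast
  have "(\<lambda>k. V k \<bullet> d - S' (X k) d) \<longlonglongrightarrow> v \<bullet> d - S' z d"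
    using X V by (intro tendsto_intros isCont_tendsto_compose[OF cont])
  moreover have "\<forall>\<^sub>F k in sequentially. V k \<bullet> d - S' (X k) d \<le> L * norm d"
    using topological_tendstoD[OF X U]
  proof eventually_elim
    case (elim k)
    then show ?case
      using XV S U(1) lip by (intro frechet_subdifferential_lipschitz_plus_smooth)
  qed
  ultimately show ?thesis
    by (rule tendsto_upperbound) simp
qed

section \<open>Stationarity of the augmented Lagrangian and size of the infeasibility\<close>

lemma scale_pos_part:
  fixes w :: "real ^ 'm"
  assumes "0 \<le> r"
  shows "r *\<^sub>R pos_part w = pos_part (r *\<^sub>R w)"
  using assms by (simp add: vec_eq_iff pos_part_nth max_mult_distrib_left)

text \<open>Multiplying the shifted constraint values by \<open>r\<close> yields exactly the updated
  multipliers, so the derivative of the smooth part \<open>S\<close> is that of \<open>f\<close>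
  plus the multiplier term. The subgradient bound then controls this term.\<close>

lemma stationary_multipliers_bound:
  fixes g :: "real ^ 'n \<Rightarrow> real ^ 'm" and h :: "real ^ 'n \<Rightarrow> real ^ 'p"
  assumes stat: "eps_stationary e (\<lambda>y. ereal (aug_lagrangian f \<phi> g h r y l m)) z"
    and f: "\<And>y. (f has_derivative blinfun_apply (f' y)) (at y)" "continuous_on UNIV f'"
    and g: "\<And>y. (g has_derivative blinfun_apply (g' y)) (at y)" "continuous_on UNIV g'"
    and h: "\<And>y. (h has_derivative blinfun_apply (h' y)) (at y)" "continuous_on UNIV h'"
    and U: "open U" "z \<in> U" and lip: "L-lipschitz_on U \<phi>" and r: "r > 0"
  shows "\<bar>pos_part (l + r *\<^sub>R g z) \<bullet> g' z d + (m + r *\<^sub>R h z) \<bullet> h' z d\<bar>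
    \<le> (L + e + norm (f' z)) * norm d"
proof -
  define S where "S = (\<lambda>y. f y + r / 2 * ((norm (pos_part (g y + (1 / r) *\<^sub>R l)))\<^sup>2
    + (norm (h y + (1 / r) *\<^sub>R m))\<^sup>2))"
  define S' where "S' = (\<lambda>y d. f' y d + r / 2 * (2 * (pos_part (g y + (1 / r) *\<^sub>R l) \<bullet> g' y d
    + (h y + (1 / r) *\<^sub>R m) \<bullet> h' y d)))"
  obtain \<eta> where \<eta>: "\<eta> \<in> limiting_subdifferential (\<lambda>y. ereal (\<phi> y + S y)) z" "norm \<eta> \<le> e"
    using stat unfolding eps_stationary_def aug_lagrangian_def S_def
    by (auto simp: algebra_simps)
  have der: "(S has_derivative S' y) (at y)" for y
    unfolding S_def S'_def
    by (intro has_derivative_add has_derivative_mult_right shifted_penalty_has_derivative f g h)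
  have [continuous_intros]: "isCont g z" "isCont h z" "isCont f' z" "isCont g' z" "isCont h' z"
    using f(2) g(2) h(2) has_derivative_continuous[OF g(1)] has_derivative_continuous[OF h(1)]
    by (auto simp: continuous_on_eq_continuous_at)
  have pos: "isCont (\<lambda>y. pos_part (g y + (1 / r) *\<^sub>R l)) z"
    using \<open>isCont g z\<close> unfolding isCont_def
    by (intro vec_tendstoI) (simp only: pos_part_nth vector_add_component, intro tendsto_intros)
  have cont: "isCont (\<lambda>y. S' y d) z" for d
    unfolding S'_def by (intro continuous_intros pos)
  define A where "A = (\<lambda>d. pos_part (l + r *\<^sub>R g z) \<bullet> g' z d + (m + r *\<^sub>R h z) \<bullet> h' z d)"
  have S'A: "S' z d = f' z d + A d" for d
  proof -
    have pos: "pos_part (l + r *\<^sub>R g z) = r *\<^sub>R pos_part (g z + (1 / r) *\<^sub>R l)"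
      using r by (simp add: scale_pos_part algebra_simps)
    have "m + r *\<^sub>R h z = r *\<^sub>R (h z + (1 / r) *\<^sub>R m)"
      using r by (simp add: algebra_simps)
    then show ?thesis
      unfolding S'_def A_def pos inner_scaleR_left by (simp add: distrib_left)
  qed
  have lower: "- A d \<le> (L + e + norm (f' z)) * norm d" for d
  proof -
    have "\<eta> \<bullet> d - S' z d \<le> L * norm d"
      by (rule limiting_subdifferential_lipschitz_plus_smooth[OF \<eta>(1) der cont U lip])
    moreover have "\<bar>\<eta> \<bullet> d\<bar> \<le> e * norm d"
      using Cauchy_Schwarz_ineq2[of \<eta> d] mult_right_mono[OF \<eta>(2), of "norm d"] by simp
    moreover have "\<bar>f' z d\<bar> \<le> norm (f' z) * norm d"
      using norm_blinfun[of "f' z" d] by simp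
    ultimately show ?thesis
      by (simp add: S'A algebra_simps)
  qed
  \<comment> \<open>The subgradient bound is one-sided; applying it to \<open>d\<close> and to
    \<open>- d\<close> gives the absolute value.\<close>
  have "A (- d) = - A d"
    by (simp add: A_def blinfun.minus_right)
  with lower[of d] lower[of "- d"] show ?thesis
    unfolding A_def by simp
qed

text \<open>The factor \<open>sqrt 2\<close> would be sharp; with 2 a comparison of squares
  suffices.\<close>

lemma norm_infeasibility_le:
  "norm (pos_part (g y)) \<le> 2 * sqrt (infeasibility g h y)"
  "norm (h y) \<le> 2 * sqrt (infeasibility g h y)"
proof -
  have "(norm (pos_part (g y)) / 2)\<^sup>2 \<le> infeasibility g h y"
    "(norm (h y) / 2)\<^sup>2 \<le> infeasibility g h y"
    by (simp_all add: infeasibility_def power_divide)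
  then have "norm (pos_part (g y)) / 2 \<le> sqrt (infeasibility g h y)"
    "norm (h y) / 2 \<le> sqrt (infeasibility g h y)"
    by (blast intro: real_le_rsqrt)+
  then show "norm (pos_part (g y)) \<le> 2 * sqrt (infeasibility g h y)"
    "norm (h y) \<le> 2 * sqrt (infeasibility g h y)"
    by linarith+
qed

section \<open>Estimates for a single step of the method\<close>

context SALM
begin

lemma rho_pos: "\<rho> k > 0"
  by (induction k) (use rho_0_pos gamma_gt_1 rho_step in auto)

text \<open>Norms of constant vectors that dominate every \<open>u k\<close> and \<open>v k\<close>
  componentwise in absolute value, hence bounds uniform in \<open>k\<close>.\<close>

definition "lam_gap = norm (vec u_max :: real ^ 'm)"
definition "mu_gap = norm (vec (\<bar>v_min\<bar> + \<bar>v_max\<bar>) :: real ^ 'p)"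

text \<open>Taking the positive part is nonexpansive, so dropping \<open>u k\<close> from its
  argument moves each component by at most \<open>u_max\<close>.\<close>

lemma norm_lam_diff_le: "norm (lam (Suc k) - \<rho> k *\<^sub>R pos_part (g (x (Suc k)))) \<le> lam_gap"
  unfolding lam_gap_def
proof (rule norm_le_componentwise_cart)
  fix i
  have "0 \<le> u k $ i" "u k $ i \<le> u_max"
    using u_bounds[of k i] by auto
  then show "norm ((lam (Suc k) - \<rho> k *\<^sub>R pos_part (g (x (Suc k)))) $ i)
      \<le> norm (vec u_max $ i :: real)"
    using rho_pos[of k] by (simp add: lam_step scale_pos_part pos_part_nth max_def)
qed

lemma norm_mu_diff_le: "norm (mu (Suc k) - \<rho> k *\<^sub>R h (x (Suc k))) \<le> mu_gap"
  unfolding mu_gap_def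
proof (rule norm_le_componentwise_cart)
  fix j
  show "norm ((mu (Suc k) - \<rho> k *\<^sub>R h (x (Suc k))) $ j)
      \<le> norm (vec (\<bar>v_min\<bar> + \<bar>v_max\<bar>) $ j :: real)"
    using v_bounds[of k j] by (auto simp: mu_step)
qed

text \<open>The stationarity bound is tested in the direction of the gradient \<open>?G\<close>
  itself. This bounds \<open>\<rho> k * (norm ?G)\<^sup>2\<close> by a multiple of
  \<open>norm ?G\<close>, and one factor cancels.\<close>

lemma norm_gradient_infeasibility_le:
  assumes f: "\<And>y. (f has_derivative blinfun_apply (f' y)) (at y)" "continuous_on UNIV f'"
    and g: "\<And>y. (g has_derivative blinfun_apply (g' y)) (at y)" "continuous_on UNIV g'"
    and h: "\<And>y. (h has_derivative blinfun_apply (h' y)) (at y)" "continuous_on UNIV h'"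
    and U: "open U" "x (Suc k) \<in> U" and lip: "L-lipschitz_on U \<phi>"
  shows "\<rho> k * norm (gradient (infeasibility g h) (x (Suc k)))
    \<le> L + \<epsilon> k + norm (f' (x (Suc k))) + lam_gap * norm (g' (x (Suc k)))
      + mu_gap * norm (h' (x (Suc k)))" (is "_ * norm ?G \<le> ?C")
proof (cases "?G = 0")
  case True
  have "0 \<le> L" using lip by (rule lipschitz_on_nonneg)
  with True eps_pos[of k] show ?thesis
    by (simp add: lam_gap_def mu_gap_def)
next
  case False
  let ?z = "x (Suc k)"
  have "\<bar>lam (Suc k) \<bullet> g' ?z ?G + mu (Suc k) \<bullet> h' ?z ?G\<bar> \<le> (L + \<epsilon> k + norm (f' ?z)) * norm ?G"
    using stationary_multipliers_bound[OF x_step f g h U lip rho_pos]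
    by (simp add: lam_step mu_step)
  moreover have "\<bar>(lam (Suc k) - \<rho> k *\<^sub>R pos_part (g ?z)) \<bullet> g' ?z ?G\<bar>
      \<le> lam_gap * (norm (g' ?z) * norm ?G)"
    by (rule order_trans[OF Cauchy_Schwarz_ineq2])
      (intro mult_mono norm_lam_diff_le norm_blinfun, auto simp: lam_gap_def)
  moreover have "\<bar>(mu (Suc k) - \<rho> k *\<^sub>R h ?z) \<bullet> h' ?z ?G\<bar>
      \<le> mu_gap * (norm (h' ?z) * norm ?G)"
    by (rule order_trans[OF Cauchy_Schwarz_ineq2])
      (intro mult_mono norm_mu_diff_le norm_blinfun, auto simp: mu_gap_def)
  \<comment> \<open>The multipliers are inserted in place of the scaled constraint values; the two
    correction terms are those bounded just above.\<close>
  moreover have "\<rho> k * (?G \<bullet> ?G) = lam (Suc k) \<bullet> g' ?z ?G + mu (Suc k) \<bullet> h' ?z ?G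
      - (lam (Suc k) - \<rho> k *\<^sub>R pos_part (g ?z)) \<bullet> g' ?z ?G
      - (mu (Suc k) - \<rho> k *\<^sub>R h ?z) \<bullet> h' ?z ?G"
    unfolding inner_gradient_infeasibility[OF g(1) h(1)]
    by (simp add: inner_diff_left algebra_simps)
  ultimately have "\<rho> k * (?G \<bullet> ?G) \<le> ?C * norm ?G"
    unfolding distrib_right by linarith
  then have "(\<rho> k * norm ?G) * norm ?G \<le> ?C * norm ?G"
    by (simp add: dot_square_norm power2_eq_square mult.assoc)
  with False show ?thesis
    by (simp add: mult_le_cancel_right)
qed

text \<open>The inequality \<open>pl\<close> turns the gradient bound into a bound on
  \<open>\<rho> k\<close> times the positive part of \<open>g\<close> and times \<open>h\<close>;
  the multipliers differ from these products by at most the gaps.\<close>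

lemma norm_multipliers_le:
  assumes f: "\<And>y. (f has_derivative blinfun_apply (f' y)) (at y)" "continuous_on UNIV f'"
    and g: "\<And>y. (g has_derivative blinfun_apply (g' y)) (at y)" "continuous_on UNIV g'"
    and h: "\<And>y. (h has_derivative blinfun_apply (h' y)) (at y)" "continuous_on UNIV h'"
    and U: "open U" "x (Suc k) \<in> U" and lip: "L-lipschitz_on U \<phi>"
    and pl: "sqrt (infeasibility g h (x (Suc k)))
      \<le> \<nu> * norm (gradient (infeasibility g h) (x (Suc k)))" and "\<nu> > 0"
  defines "C \<equiv> 2 * \<nu> * (L + \<epsilon> k + norm (f' (x (Suc k))) + lam_gap * norm (g' (x (Suc k)))
      + mu_gap * norm (h' (x (Suc k))))"
  shows "norm (lam (Suc k)) \<le> C + lam_gap" "norm (mu (Suc k)) \<le> C + mu_gap"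
proof -
  let ?z = "x (Suc k)"
  have "\<rho> k * (2 * sqrt (infeasibility g h ?z))
      \<le> 2 * \<nu> * (\<rho> k * norm (gradient (infeasibility g h) ?z))"
    using mult_left_mono[OF pl, of "2 * \<rho> k"] rho_pos[of k] by (simp add: mult_ac)
  also have "\<dots> \<le> C"
    unfolding C_def using norm_gradient_infeasibility_le[OF f g h U lip] \<open>\<nu> > 0\<close>
    by (intro mult_left_mono) auto
  finally have C: "\<rho> k * (2 * sqrt (infeasibility g h ?z)) \<le> C" .
  have "norm (\<rho> k *\<^sub>R pos_part (g ?z)) \<le> C" "norm (\<rho> k *\<^sub>R h ?z) \<le> C"
    using rho_pos[of k] norm_infeasibility_le[where y = ?z and g = g and h = h]
    by (auto intro!: order_trans[OF _ C] mult_left_mono)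
  with norm_lam_diff_le[of k] norm_mu_diff_le[of k]
  show "norm (lam (Suc k)) \<le> C + lam_gap" "norm (mu (Suc k)) \<le> C + mu_gap"
    by (smt (verit) norm_triangle_sub)+
qed

end

section \<open>Boundedness along the subsequence\<close>

lemma bounded_image_enumerate:
  fixes F :: "nat \<Rightarrow> 'a::real_normed_vector"
  assumes "infinite K" and "\<forall>\<^sub>F j in sequentially. norm (F (enumerate K j)) \<le> B"
  shows "bounded (F ` K)"
proof -
  have "Bseq (\<lambda>j. F (enumerate K j))"
    using assms(2) by (rule BfunI)
  moreover have "range (\<lambda>j. F (enumerate K j)) = F ` K"
    using range_enumerate[OF assms(1)] by (metis image_image)
  ultimately show ?thesis
    by (simp add: Bseq_eq_bounded)
qed

theorem theorem3p7:
  fixes f \<phi> :: "real ^ 'n \<Rightarrow> real"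
    and g :: "real ^ 'n \<Rightarrow> real ^ 'm"
    and h :: "real ^ 'n \<Rightarrow> real ^ 'p"
    and xs :: "real ^ 'n"
    and u_max v_min v_max \<tau> \<gamma> :: real
    and u :: "nat \<Rightarrow> real ^ 'm"
    and v :: "nat \<Rightarrow> real ^ 'p"
    and \<epsilon> \<rho> :: "nat \<Rightarrow> real"
    and x :: "nat \<Rightarrow> real ^ 'n"
    and lam :: "nat \<Rightarrow> real ^ 'm"
    and mu :: "nat \<Rightarrow> real ^ 'p"
    and K :: "nat set"
  assumes "C1 f" and "C1 g" and "C1 h"
    and "locally_lipschitz \<phi>"
    and "g xs \<le> 0" and "h xs = 0"
    and "PLCQ g h xs"
    and "SALM f \<phi> g h u_max v_min v_max \<tau> \<gamma> u v \<epsilon> \<rho> x lam mu"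
    and "infinite K"
    and "(\<lambda>j. x (enumerate K j)) \<longlonglongrightarrow> xs"
  shows "bounded (lam ` K) \<and> bounded (mu ` K)"
proof -
  interpret SALM f \<phi> g h u_max v_min v_max \<tau> \<gamma> u v \<epsilon> \<rho> x lam mu by fact
  obtain f' g' h' where
    f: "\<And>y. (f has_derivative blinfun_apply (f' y)) (at y)" "continuous_on UNIV f'" and
    g: "\<And>y. (g has_derivative blinfun_apply (g' y)) (at y)" "continuous_on UNIV g'" and
    h: "\<And>y. (h has_derivative blinfun_apply (h' y)) (at y)" "continuous_on UNIV h'"
    using \<open>C1 f\<close> \<open>C1 g\<close> \<open>C1 h\<close> unfolding C1_def by metis
  obtain r L where "r > 0" and lip: "L-lipschitz_on (ball xs r) \<phi>"
    using \<open>locally_lipschitz \<phi>\<close> unfolding locally_lipschitz_def by blast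
  obtain \<nu> \<delta> where "\<nu> > 0" "\<delta> > 0" and pl: "\<And>y. y \<in> ball xs \<delta> \<Longrightarrow>
      sqrt (infeasibility g h y) \<le> \<nu> * norm (gradient (infeasibility g h) y)"
    using \<open>PLCQ g h xs\<close> unfolding PLCQ_def by blast
  let ?y = "\<lambda>j. x (enumerate K j)"
  have lim: "?y \<longlonglongrightarrow> xs" by fact
  \<comment> \<open>Continuity of the derivatives at the limit point makes every
    \<open>k\<close>-dependent term of the single-step bound uniformly bounded along
    \<open>K\<close>.\<close>
  have "isCont f' xs" "isCont g' xs" "isCont h' xs"
    using f(2) g(2) h(2) by (auto simp: continuous_on_eq_continuous_at)
  then have "(\<lambda>j. f' (?y j)) \<longlonglongrightarrow> f' xs" "(\<lambda>j. g' (?y j)) \<longlonglongrightarrow> g' xs"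
      "(\<lambda>j. h' (?y j)) \<longlonglongrightarrow> h' xs"
    by (blast intro: isCont_tendsto_compose[OF _ lim])+
  then have "Bseq (\<lambda>j. f' (?y j))" "Bseq (\<lambda>j. g' (?y j))" "Bseq (\<lambda>j. h' (?y j))" "Bseq \<epsilon>"
    using eps_tendsto by (blast intro: convergent_imp_Bseq convergentI)+
  then obtain F G H E where bounds: "\<And>j. norm (f' (?y j)) \<le> F" "\<And>j. norm (g' (?y j)) \<le> G"
      "\<And>j. norm (h' (?y j)) \<le> H" "\<And>k. norm (\<epsilon> k) \<le> E"
    unfolding Bseq_def by metis
  define C where "C = 2 * \<nu> * (L + E + F + lam_gap * G + mu_gap * H)"
  have "\<forall>\<^sub>F j in sequentially. ?y j \<in> ball xs r"
    by (rule topological_tendstoD[OF lim]) (use \<open>r > 0\<close> in auto)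
  moreover have "\<forall>\<^sub>F j in sequentially. ?y j \<in> ball xs \<delta>"
    by (rule topological_tendstoD[OF lim]) (use \<open>\<delta> > 0\<close> in auto)
  ultimately have "\<forall>\<^sub>F j in sequentially. norm (lam (enumerate K j)) \<le> C + lam_gap \<and>
      norm (mu (enumerate K j)) \<le> C + mu_gap"
    \<comment> \<open>For \<open>j > 0\<close> the index \<open>enumerate K j\<close> is at least
      \<open>j\<close>, hence a successor. This excludes the starting multipliers
      \<open>lam 0\<close> and \<open>mu 0\<close>, which no update produced.\<close>
    using eventually_gt_at_top[of 0]
  proof eventually_elim
    case (elim j)
    then obtain k where k: "enumerate K j = Suc k"
      using le_enumerate[OF \<open>infinite K\<close>, of j] by (cases "enumerate K j") auto
    have "2 * \<nu> * (L + \<epsilon> k + norm (f' (x (Suc k))) + lam_gap * norm (g' (x (Suc k)))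
        + mu_gap * norm (h' (x (Suc k)))) \<le> C"
      unfolding C_def using bounds(1-3)[of j] bounds(4)[of k] \<open>\<nu> > 0\<close>
      by (intro mult_left_mono add_mono) (auto simp: k lam_gap_def mu_gap_def)
    with norm_multipliers_le[OF f g h open_ball _ lip pl \<open>\<nu> > 0\<close>, of k] elim show ?case
      by (auto simp: k)
  qed
  then show ?thesis
    using \<open>infinite K\<close> by (auto intro!: bounded_image_enumerate elim: eventually_mono)
qed

end
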